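(* Let $S=\langle U,\iota\rangle$ be an FO-identifiable $3$-valued structure with finite node set $U=\{u_1,\dots,u_n\}$ and node formulas $\mathit{node}^S_{u}(w)$ ($u\in U$) witnessing FO-identifiability. Define the closed formula $$\xi^S := \bigwedge_{i=1}^n \exists v.\,\mathit{node}^S_{u_i}(v)\ \wedge\ \forall w.\,\bigvee_{i=1}^n \mathit{node}^S_{u_i}(w)\ \wedge\ \bigwedge_{p\in\mathcal{P}_0} p^{\iota(p)()}\ \wedge\ \bigwedge_{r=1}^{\mathit{maxR}}\bigwedge_{p\in\mathcal{P}_r} \forall w_1,\dots,w_r.\bigwedge_{(u'_1,\dots,u'_r)\in U^r}\Big(\bigwedge_{j=1}^r \mathit{node}^S_{u'_j}(w_j)\Rightarrow p^{\iota(p)(u'_1,\dots,u'_r)}(w_1,\dots,w_r)\Big),$$ and $\widehat{\gamma}(S):=F\wedge\xi^S$. Then for every $2$-valued structure $S^\natural$: $S^\natural\in\gamma(S)$ iff $S^\natural\models\widehat{\gamma}(S)$.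
   Context: Fix a finite vocabulary $\mathcal{P}$ of predicate symbols containing a designated binary symbol $eq$; $\mathcal{P}_i$ denotes the symbols of arity $i$ and $\mathit{maxR}$ the maximal arity. Formulas are those of first-order logic with transitive closure over $\mathcal{P}$ with the standard semantics. Fix a closed formula $F$ (the integrity formula). A $2$-valued structure is $S=\langle U,\iota\rangle$ ($U$ a possibly infinite set) with $\iota(p):U^i\to\{0,1\}$ for $p\in\mathcal{P}_i$, $\iota(eq)$ being equality. A $3$-valued structure is $S=\langle U,\iota\rangle$ with $\iota(p):U^i\to\{0,1,1/2\}$, $\iota(eq)(u,u)\in\{1,1/2\}$, and $\iota(eq)(u_1,u_2)=0$ for distinct $u_1,u_2$. Information order: $l_1\sqsubseteq l_2$ iff $l_1=l_2$ or $l_2=1/2$. A surjective $f:U^S\to U^{S'}$ embeds $S$ into $S'$ if $\iota^S(p)(u_1,\dots,u_i)\sqsubseteq \iota^{S'}(p)(f(u_1),\dots,f(u_i))$ for all $p\in\mathcal{P}_i$ and all $u_1,\dots,u_i\in U^S$; $S$ embeds into $S'$ if such $f$ exists. For a set $X$ of $3$-valued structures, $\gamma(X)$ is the set of $2$-valued structures $S^\natural$ such that $S^\natural\models F$ and $S^\natural$ embeds into some $S\in X$; $\gamma(S):=\gamma(\{S\})$. A $3$-valued structure $S$ is FO-identifiable if for every $u\in U^S$ there is a first-order formula $\mathit{node}^S_u(w)$ with free variable $w$ such that for every $2$-valued $S^\natural$ embedding into $S$ via $f$, every $u^\natural\in U^{S^\natural}$ and every $u_i\in U^S$: $f(u^\natural)=u_i$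 iff $S^\natural,[w\mapsto u^\natural]\models\mathit{node}^S_{u_i}(w)$. For a $k$-ary $p$ and $B\in\{0,1,1/2\}$: $p^0(\bar v):=\neg p(\bar v)$, $p^1(\bar v):=p(\bar v)$, $p^{1/2}(\bar v):=\mathit{true}$ (for nullary $p$, with empty argument list). *)

theory Defs
  imports Main
begin

record 'p vocab =
  preds :: "'p set"
  arity :: "'p \<Rightarrow> nat"
  eqsym :: "'p"

definition vocabulary :: "'p vocab \<Rightarrow> bool" where
  "vocabulary V \<longleftrightarrow> finite (preds V) \<and> eqsym V \<in> preds V \<and> arity V (eqsym V) = 2"

definition preds_of_arity :: "'p vocab \<Rightarrow> nat \<Rightarrow> 'p set" where
  "preds_of_arity V i = {p \<in> preds V. arity V p = i}"

definition maxR :: "'p vocab \<Rightarrow> nat" where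
  "maxR V = Max (arity V ` preds V)"

type_synonym var = nat

text \<open>In \<open>TC x y \<phi> a b\<close> the variables \<open>x\<close> and \<open>y\<close> are bound in \<open>\<phi>\<close>;
  it is usually written \<open>(TC x,y : \<phi>)(a,b)\<close>.\<close>

datatype 'p form =
    Tt
  | Ff
  | Pred 'p "var list"
  | Neg "'p form"
  | Conj "'p form" "'p form"
  | Disj "'p form" "'p form"
  | Impl "'p form" "'p form"
  | Exists var "'p form"
  | Forall var "'p form"
  | TC var var "'p form" var var

primrec wff :: "'p vocab \<Rightarrow> 'p form \<Rightarrow> bool" where
  "wff V Tt \<longleftrightarrow> True"
| "wff V Ff \<longleftrightarrow> True"
| "wff V (Pred p xs) \<longleftrightarrow> p \<in> preds V \<and> length xs = arity V p"
| "wff V (Neg \<phi>) \<longleftrightarrow> wff V \<phi>"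
| "wff V (Conj \<phi> \<psi>) \<longleftrightarrow> wff V \<phi> \<and> wff V \<psi>"
| "wff V (Disj \<phi> \<psi>) \<longleftrightarrow> wff V \<phi> \<and> wff V \<psi>"
| "wff V (Impl \<phi> \<psi>) \<longleftrightarrow> wff V \<phi> \<and> wff V \<psi>"
| "wff V (Exists x \<phi>) \<longleftrightarrow> wff V \<phi>"
| "wff V (Forall x \<phi>) \<longleftrightarrow> wff V \<phi>"
| "wff V (TC x y \<phi> a b) \<longleftrightarrow> x \<noteq> y \<and> wff V \<phi>"

primrec first_order :: "'p form \<Rightarrow> bool" where
  "first_order Tt \<longleftrightarrow> True"
| "first_order Ff \<longleftrightarrow> True"
| "first_order (Pred p xs) \<longleftrightarrow> True"
| "first_order (Neg \<phi>) \<longleftrightarrow> first_order \<phi>"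
| "first_order (Conj \<phi> \<psi>) \<longleftrightarrow> first_order \<phi> \<and> first_order \<psi>"
| "first_order (Disj \<phi> \<psi>) \<longleftrightarrow> first_order \<phi> \<and> first_order \<psi>"
| "first_order (Impl \<phi> \<psi>) \<longleftrightarrow> first_order \<phi> \<and> first_order \<psi>"
| "first_order (Exists x \<phi>) \<longleftrightarrow> first_order \<phi>"
| "first_order (Forall x \<phi>) \<longleftrightarrow> first_order \<phi>"
| "first_order (TC x y \<phi> a b) \<longleftrightarrow> False"

primrec fv :: "'p form \<Rightarrow> var set" where
  "fv Tt = {}"
| "fv Ff = {}"
| "fv (Pred p xs) = set xs"
| "fv (Neg \<phi>) = fv \<phi>"
| "fv (Conj \<phi> \<psi>) = fv \<phi> \<union> fv \<psi>"
| "fv (Disj \<phi> \<psi>) = fv \<phi> \<union> fv \<psi>"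
| "fv (Impl \<phi> \<psi>) = fv \<phi> \<union> fv \<psi>"
| "fv (Exists x \<phi>) = fv \<phi> - {x}"
| "fv (Forall x \<phi>) = fv \<phi> - {x}"
| "fv (TC x y \<phi> a b) = (fv \<phi> - {x, y}) \<union> {a, b}"

definition avoid :: "var \<Rightarrow> var set \<Rightarrow> var" where
  "avoid x A = (if x \<in> A then (LEAST z. z \<notin> A) else x)"

text \<open>Capture-avoiding renaming of the free variables by \<open>\<sigma>\<close>: a bound variable is
  changed only if it would capture a renamed free variable.\<close>

primrec rename :: "(var \<Rightarrow> var) \<Rightarrow> 'p form \<Rightarrow> 'p form" where
  "rename \<sigma> Tt = Tt"
| "rename \<sigma> Ff = Ff"
| "rename \<sigma> (Pred p xs) = Pred p (map \<sigma> xs)"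
| "rename \<sigma> (Neg \<phi>) = Neg (rename \<sigma> \<phi>)"
| "rename \<sigma> (Conj \<phi> \<psi>) = Conj (rename \<sigma> \<phi>) (rename \<sigma> \<psi>)"
| "rename \<sigma> (Disj \<phi> \<psi>) = Disj (rename \<sigma> \<phi>) (rename \<sigma> \<psi>)"
| "rename \<sigma> (Impl \<phi> \<psi>) = Impl (rename \<sigma> \<phi>) (rename \<sigma> \<psi>)"
| "rename \<sigma> (Exists x \<phi>) =
    (let x' = avoid x (\<sigma> ` (fv \<phi> - {x})) in Exists x' (rename (\<sigma>(x := x')) \<phi>))"
| "rename \<sigma> (Forall x \<phi>) =
    (let x' = avoid x (\<sigma> ` (fv \<phi> - {x})) in Forall x' (rename (\<sigma>(x := x')) \<phi>))"
| "rename \<sigma> (TC x y \<phi> a b) =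
    (let A = \<sigma> ` (fv \<phi> - {x, y}); x' = avoid x A; y' = avoid y (insert x' A)
     in TC x' y' (rename (\<sigma>(x := x', y := y')) \<phi>) (\<sigma> a) (\<sigma> b))"

definition subst_var :: "'p form \<Rightarrow> var \<Rightarrow> var \<Rightarrow> 'p form" where
  "subst_var \<phi> x y = rename (id(x := y)) \<phi>"

datatype tv = Zero | One | Half

definition info_le :: "tv \<Rightarrow> tv \<Rightarrow> bool" (infix \<open>\<sqsubseteq>\<close> 50) where
  "l1 \<sqsubseteq> l2 \<longleftrightarrow> l1 = l2 \<or> l2 = Half"

record ('p, 'a) struct =
  universe :: "'a set"
  interp :: "'p \<Rightarrow> 'a list \<Rightarrow> tv"

definition tuples :: "'a set \<Rightarrow> nat \<Rightarrow> 'a list set" where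
  "tuples U i = {us. set us \<subseteq> U \<and> length us = i}"

definition two_valued :: "'p vocab \<Rightarrow> ('p, 'a) struct \<Rightarrow> bool" where
  "two_valued V S \<longleftrightarrow>
     (\<forall>p \<in> preds V. \<forall>us \<in> tuples (universe S) (arity V p). interp S p us \<in> {Zero, One}) \<and>
     (\<forall>u \<in> universe S. \<forall>u' \<in> universe S.
        interp S (eqsym V) [u, u'] = (if u = u' then One else Zero))"

text \<open>No condition is imposed on the remaining predicates, since \<^typ>\<open>tv\<close> has exactly
  the three truth values.\<close>

definition three_valued :: "'p vocab \<Rightarrow> ('p, 'a) struct \<Rightarrow> bool" where
  "three_valued V S \<longleftrightarrow>
     (\<forall>u \<in> universe S. interp S (eqsym V) [u, u] \<in> {One, Half}) \<and>
     (\<forall>u \<in> universe S. \<forall>u' \<in> universe S. u \<noteq> u' \<longrightarrow> interp S (eqsym V) [u, u'] = Zero)"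

text \<open>Satisfaction is only used for two-valued structures and for assignments defined on
  all free variables of the formula. \<open>TC\<close> is the transitive, not the reflexive-transitive,
  closure.\<close>

primrec sat :: "('p, 'a) struct \<Rightarrow> (var \<rightharpoonup> 'a) \<Rightarrow> 'p form \<Rightarrow> bool" where
  "sat S Z Tt \<longleftrightarrow> True"
| "sat S Z Ff \<longleftrightarrow> False"
| "sat S Z (Pred p xs) \<longleftrightarrow> interp S p (map (\<lambda>x. the (Z x)) xs) = One"
| "sat S Z (Neg \<phi>) \<longleftrightarrow> \<not> sat S Z \<phi>"
| "sat S Z (Conj \<phi> \<psi>) \<longleftrightarrow> sat S Z \<phi> \<and> sat S Z \<psi>"
| "sat S Z (Disj \<phi> \<psi>) \<longleftrightarrow> sat S Z \<phi> \<or> sat S Z \<psi>"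
| "sat S Z (Impl \<phi> \<psi>) \<longleftrightarrow> (sat S Z \<phi> \<longrightarrow> sat S Z \<psi>)"
| "sat S Z (Exists x \<phi>) \<longleftrightarrow> (\<exists>u \<in> universe S. sat S (Z(x \<mapsto> u)) \<phi>)"
| "sat S Z (Forall x \<phi>) \<longleftrightarrow> (\<forall>u \<in> universe S. sat S (Z(x \<mapsto> u)) \<phi>)"
| "sat S Z (TC x y \<phi> a b) \<longleftrightarrow>
    (the (Z a), the (Z b)) \<in>
      {(u, u'). u \<in> universe S \<and> u' \<in> universe S \<and> sat S (Z(x \<mapsto> u, y \<mapsto> u')) \<phi>}\<^sup>+"

definition models :: "('p, 'a) struct \<Rightarrow> 'p form \<Rightarrow> bool" (infix \<open>\<Turnstile>\<close> 50) where
  "S \<Turnstile> \<phi> \<longleftrightarrow> sat S Map.empty \<phi>"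

definition embeds_via ::
  "'p vocab \<Rightarrow> ('a \<Rightarrow> 'b) \<Rightarrow> ('p, 'a) struct \<Rightarrow> ('p, 'b) struct \<Rightarrow> bool" where
  "embeds_via V f S S' \<longleftrightarrow>
     f ` universe S = universe S' \<and>
     (\<forall>p \<in> preds V. \<forall>us \<in> tuples (universe S) (arity V p).
        interp S p us \<sqsubseteq> interp S' p (map f us))"

definition embeds :: "'p vocab \<Rightarrow> ('p, 'a) struct \<Rightarrow> ('p, 'b) struct \<Rightarrow> bool" where
  "embeds V S S' \<longleftrightarrow> (\<exists>f. embeds_via V f S S')"

definition concretization_set ::
  "'p vocab \<Rightarrow> 'p form \<Rightarrow> ('p, 'a) struct set \<Rightarrow> ('p, 'b) struct set" where
  "concretization_set V F X = {N. two_valued V N \<and> N \<Turnstile> F \<and> (\<exists>S \<in> X. embeds V N S)}"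

definition concretization ::
  "'p vocab \<Rightarrow> 'p form \<Rightarrow> ('p, 'a) struct \<Rightarrow> ('p, 'b) struct set" where
  "concretization V F S = concretization_set V F {S}"

text \<open>The type argument is the type from which the nodes of the two-valued structures
  are drawn: HOL cannot quantify over all types inside a formula.\<close>

definition FO_identifiable_by ::
  "'b itself \<Rightarrow> 'p vocab \<Rightarrow> ('p, 'a) struct \<Rightarrow> var \<Rightarrow> ('a \<Rightarrow> 'p form) \<Rightarrow> bool" where
  "FO_identifiable_by T V S w nd \<longleftrightarrow>
     (\<forall>u \<in> universe S. wff V (nd u) \<and> first_order (nd u) \<and> fv (nd u) \<subseteq> {w}) \<and>
     (\<forall>(N :: ('p, 'b) struct) f. two_valued V N \<and> embeds_via V f N S \<longrightarrow>
        (\<forall>x \<in> universe N. \<forall>u \<in> universe S. f x = u \<longleftrightarrow> sat N [w \<mapsto> x] (nd u)))"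

definition FO_identifiable ::
  "'b itself \<Rightarrow> 'p vocab \<Rightarrow> ('p, 'a) struct \<Rightarrow> bool" where
  "FO_identifiable T V S \<longleftrightarrow> (\<exists>w nd. FO_identifiable_by T V S w nd)"

text \<open>Conjunctions and disjunctions over a finite index set are built along an arbitrary
  enumeration of that set.\<close>

definition enumeration :: "'i set \<Rightarrow> 'i list" where
  "enumeration A = (SOME xs. distinct xs \<and> set xs = A)"

definition BigConj :: "'i set \<Rightarrow> ('i \<Rightarrow> 'p form) \<Rightarrow> 'p form" where
  "BigConj A \<phi> = foldr Conj (map \<phi> (enumeration A)) Tt"

definition BigDisj :: "'i set \<Rightarrow> ('i \<Rightarrow> 'p form) \<Rightarrow> 'p form" where
  "BigDisj A \<phi> = foldr Disj (map \<phi> (enumeration A)) Ff"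

definition Foralls :: "var list \<Rightarrow> 'p form \<Rightarrow> 'p form" where
  "Foralls xs \<phi> = foldr Forall xs \<phi>"

fun literal :: "'p \<Rightarrow> tv \<Rightarrow> var list \<Rightarrow> 'p form" where
  "literal p Zero xs = Neg (Pred p xs)"
| "literal p One xs = Pred p xs"
| "literal p Half xs = Tt"

text \<open>The variable \<open>v\<close> of the usual presentation is \<open>0\<close> and \<open>w\<^sub>j\<close> is \<open>j\<close>. They may coincide
  with \<open>w\<close> or with bound variables of the node formulas, since \<^const>\<open>subst_var\<close> avoids
  capture and \<open>w\<close> is the only free variable there. Tuples are lists, so that the \<open>j\<close>-th
  component of \<open>us\<close> is \<open>us ! (j - 1)\<close>.\<close>

definition xi :: "'p vocab \<Rightarrow> ('p, 'a) struct \<Rightarrow> var \<Rightarrow> ('a \<Rightarrow> 'p form) \<Rightarrow> 'p form" where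
  "xi V S w nd =
     Conj (BigConj (universe S) (\<lambda>u. Exists 0 (subst_var (nd u) w 0)))
    (Conj (Forall w (BigDisj (universe S) (\<lambda>u. nd u)))
    (Conj (BigConj (preds_of_arity V 0) (\<lambda>p. literal p (interp S p []) []))
          (BigConj {1..maxR V} (\<lambda>r. BigConj (preds_of_arity V r) (\<lambda>p.
             Foralls [1..<Suc r]
               (BigConj (tuples (universe S) r) (\<lambda>us.
                  Impl (BigConj {1..r} (\<lambda>j. subst_var (nd (us ! (j - 1))) w j))
                       (literal p (interp S p us) [1..<Suc r]))))))))"

definition gamma_hat ::
  "'p vocab \<Rightarrow> 'p form \<Rightarrow> ('p, 'a) struct \<Rightarrow> var \<Rightarrow> ('a \<Rightarrow> 'p form) \<Rightarrow> 'p form" where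
  "gamma_hat V F S w nd = Conj F (xi V S w nd)"

end

theory Submission
  imports Defs
begin

text \<open>If \<open>N\<close> embeds into \<open>S\<close> via \<open>f\<close>, the node formulas define the fibres of \<open>f\<close> and every conjunct
  of \<open>xi\<close> is read off the embedding. Conversely, in a model of \<open>xi\<close> every element satisfies some
  node formula; choosing one gives \<open>f\<close>. Surjectivity of \<open>f\<close> requires the node formulas to be
  mutually exclusive in \<open>N\<close>, and identifiability cannot be used for this, since \<open>N\<close> is not yet known
  to embed into \<open>S\<close>. It follows instead from the conjunct of \<open>xi\<close> for equality, which is
  \<open>0\<close> on distinct nodes of \<open>S\<close>.\<close>

lemma finite_fv: "finite (fv \<phi>)"
  by (induction \<phi>) auto

lemma avoid_notin: "finite A \<Longrightarrow> avoid x A \<notin> A"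
  unfolding avoid_def by (metis LeastI_ex ex_new_if_finite infinite_UNIV_nat)

text \<open>The renaming and both assignments vary in the induction because binders update all
  three. The new bound variable lies outside the image of the other free variables, so updating
  \<open>Z'\<close> there leaves their values alone and restores the premise for the body.\<close>

lemma sat_rename:
  "(\<And>x. x \<in> fv \<phi> \<Longrightarrow> Z' (\<sigma> x) = Z x) \<Longrightarrow> sat S Z' (rename \<sigma> \<phi>) \<longleftrightarrow> sat S Z \<phi>"
proof (induction \<phi> arbitrary: \<sigma> Z Z')
  case (Pred p xs)
  then have "map (\<lambda>x. the (Z' x)) (map \<sigma> xs) = map (\<lambda>x. the (Z x)) xs" by simp
  then show ?case by (simp del: map_map)
next
  case (Neg \<phi>)
  have "sat S Z' (rename \<sigma> \<phi>) \<longleftrightarrow> sat S Z \<phi>" by (rule Neg.IH) (use Neg.prems in auto)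
  then show ?case by simp
next
  case (Conj \<phi> \<psi>)
  have "sat S Z' (rename \<sigma> \<phi>) \<longleftrightarrow> sat S Z \<phi>" by (rule Conj.IH) (use Conj.prems in auto)
  moreover have "sat S Z' (rename \<sigma> \<psi>) \<longleftrightarrow> sat S Z \<psi>" by (rule Conj.IH) (use Conj.prems in auto)
  ultimately show ?case by simp
next
  case (Disj \<phi> \<psi>)
  have "sat S Z' (rename \<sigma> \<phi>) \<longleftrightarrow> sat S Z \<phi>" by (rule Disj.IH) (use Disj.prems in auto)
  moreover have "sat S Z' (rename \<sigma> \<psi>) \<longleftrightarrow> sat S Z \<psi>" by (rule Disj.IH) (use Disj.prems in auto)
  ultimately show ?case by simp
next
  case (Impl \<phi> \<psi>)
  have "sat S Z' (rename \<sigma> \<phi>) \<longleftrightarrow> sat S Z \<phi>" by (rule Impl.IH) (use Impl.prems in auto)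
  moreover have "sat S Z' (rename \<sigma> \<psi>) \<longleftrightarrow> sat S Z \<psi>" by (rule Impl.IH) (use Impl.prems in auto)
  ultimately show ?case by simp
next
  case (Exists x \<phi>)
  define x' where "x' = avoid x (\<sigma> ` (fv \<phi> - {x}))"
  have "x' \<notin> \<sigma> ` (fv \<phi> - {x})" unfolding x'_def by (rule avoid_notin) (simp add: finite_fv)
  then have "sat S (Z'(x' \<mapsto> u)) (rename (\<sigma>(x := x')) \<phi>) \<longleftrightarrow> sat S (Z(x \<mapsto> u)) \<phi>" for u
    by (intro Exists.IH) (use Exists.prems in auto)
  then show ?case by (simp add: x'_def Let_def)
next
  case (Forall x \<phi>)
  define x' where "x' = avoid x (\<sigma> ` (fv \<phi> - {x}))"
  have "x' \<notin> \<sigma> ` (fv \<phi> - {x})" unfolding x'_def by (rule avoid_notin) (simp add: finite_fv)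
  then have "sat S (Z'(x' \<mapsto> u)) (rename (\<sigma>(x := x')) \<phi>) \<longleftrightarrow> sat S (Z(x \<mapsto> u)) \<phi>" for u
    by (intro Forall.IH) (use Forall.prems in auto)
  then show ?case by (simp add: x'_def Let_def)
next
  case (TC x y \<phi> a b)
  define A where "A = \<sigma> ` (fv \<phi> - {x, y})"
  define x' where "x' = avoid x A"
  \<comment> \<open>\<open>y'\<close> must also differ from \<open>x'\<close>: otherwise the update
    at \<open>y'\<close> would overwrite the value just given to \<open>x'\<close>.\<close>
  define y' where "y' = avoid y (insert x' A)"
  have "finite A" by (simp add: A_def finite_fv)
  then have "x' \<notin> A" "y' \<notin> insert x' A"
    unfolding x'_def y'_def by (simp_all only: avoid_notin finite_insert not_False_eq_True)
  then have "sat S (Z'(x' \<mapsto> u, y' \<mapsto> u')) (rename (\<sigma>(x := x', y := y')) \<phi>)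
      \<longleftrightarrow> sat S (Z(x \<mapsto> u, y \<mapsto> u')) \<phi>" for u u'
    by (intro TC.IH) (use TC.prems in \<open>auto simp: A_def\<close>)
  moreover have "Z' (\<sigma> a) = Z a" "Z' (\<sigma> b) = Z b" using TC.prems by auto
  ultimately show ?case by (simp add: A_def x'_def y'_def Let_def)
qed simp_all

text \<open>As \<open>w\<close> is the only free variable, the rest of \<open>Z\<close> is
  irrelevant. Every renamed copy of a node formula thus evaluates as one fixed unary
  predicate.\<close>

lemma sat_subst_var:
  assumes "fv \<phi> \<subseteq> {w}" and "Z y = Some a"
  shows "sat S Z (subst_var \<phi> w y) \<longleftrightarrow> sat S [w \<mapsto> a] \<phi>"
  unfolding subst_var_def by (rule sat_rename) (use assms in auto)

lemma set_enumeration: "finite A \<Longrightarrow> set (enumeration A) = A"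
  unfolding enumeration_def by (metis (mono_tags, lifting) finite_distinct_list someI_ex)

lemma sat_BigConj:
  assumes "finite A"
  shows "sat S Z (BigConj A \<phi>) \<longleftrightarrow> (\<forall>i\<in>A. sat S Z (\<phi> i))"
proof -
  \<comment> \<open>The induction runs over an arbitrary list, since \<open>enumeration\<close> is a
    choice of which only the set of elements matters.\<close>
  have "sat S Z (foldr Conj (map \<phi> is) Tt) \<longleftrightarrow> (\<forall>i\<in>set is. sat S Z (\<phi> i))" for "is"
    by (induction "is") auto
  then show ?thesis by (simp only: BigConj_def set_enumeration[OF assms])
qed

lemma sat_BigDisj:
  assumes "finite A"
  shows "sat S Z (BigDisj A \<phi>) \<longleftrightarrow> (\<exists>i\<in>A. sat S Z (\<phi> i))"
proof -
  have "sat S Z (foldr Disj (map \<phi> is) Ff) \<longleftrightarrow> (\<exists>i\<in>set is. sat S Z (\<phi> i))" for "is"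
    by (induction "is") auto
  then show ?thesis by (simp only: BigDisj_def set_enumeration[OF assms])
qed

lemma finite_tuples: "finite U \<Longrightarrow> finite (tuples U r)"
  unfolding tuples_def by (rule finite_lists_length_eq)

lemma ball_tuples_Suc:
  "(\<forall>us\<in>tuples U (Suc n). P us) \<longleftrightarrow> (\<forall>u\<in>U. \<forall>us\<in>tuples U n. P (u # us))"
  by (fastforce simp: tuples_def length_Suc_conv)

lemma sat_Foralls:
  "sat S Z (Foralls xs \<phi>) \<longleftrightarrow>
    (\<forall>us\<in>tuples (universe S) (length xs). sat S (Z(xs [\<mapsto>] us)) \<phi>)"
proof (induction xs arbitrary: Z)
  case Nil
  then show ?case by (simp add: Foralls_def tuples_def)
next
  case (Cons x xs)
  have "sat S Z (Foralls (x # xs) \<phi>) \<longleftrightarrow> (\<forall>u\<in>universe S. sat S (Z(x \<mapsto> u)) (Foralls xs \<phi>))"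
    by (simp add: Foralls_def)
  then show ?case by (simp only: Cons.IH ball_tuples_Suc length_Cons map_upds_Cons)
qed

text \<open>Distinctness keeps later updates from overwriting earlier ones.\<close>

lemma map_upds_nth:
  "distinct xs \<Longrightarrow> length xs = length us \<Longrightarrow> i < length xs \<Longrightarrow> (Z(xs [\<mapsto>] us)) (xs ! i) = Some (us ! i)"
proof (induction xs us arbitrary: i Z rule: list_induct2')
  case (4 x xs u us)
  then show ?case by (cases i) (auto simp: map_upds_apply_nontin)
qed auto

text \<open>On definite values, failing to be \<open>One\<close> means being \<open>Zero\<close>, so
  the negated literal expresses \<open>\<sqsubseteq> Zero\<close>; \<open>Half\<close> lies above
  everything and matches \<open>Tt\<close>.\<close>

lemma sat_literal:
  assumes "interp N p (map (\<lambda>x. the (Z x)) xs) \<in> {Zero, One}"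
  shows "sat N Z (literal p l xs) \<longleftrightarrow> interp N p (map (\<lambda>x. the (Z x)) xs) \<sqsubseteq> l"
  using assms by (cases l) (auto simp: info_le_def)

lemma two_valued_interp:
  assumes "two_valued V N" and "p \<in> preds V" and "xs \<in> tuples (universe N) (arity V p)"
  shows "interp N p xs \<in> {Zero, One}"
  using assms unfolding two_valued_def by blast

text \<open>This reading of \<open>xi\<close> presupposes no embedding: \<open>P\<close> is just a
  relation between nodes of \<open>S\<close> and elements of \<open>N\<close>, not yet known to be a
  function. Both directions of the theorem start from it.\<close>

lemma models_xi:
  fixes N :: "('p, 'b) struct"
  assumes V: "vocabulary V" and fin: "finite (universe S)"
    and fv: "\<forall>u\<in>universe S. fv (nd u) \<subseteq> {w}" and N: "two_valued V N"
  defines "P \<equiv> \<lambda>u x. sat N [w \<mapsto> x] (nd u)"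
  shows "N \<Turnstile> xi V S w nd \<longleftrightarrow>
    (\<forall>u\<in>universe S. \<exists>x\<in>universe N. P u x) \<and> (\<forall>x\<in>universe N. \<exists>u\<in>universe S. P u x) \<and>
    (\<forall>p\<in>preds V. \<forall>xs\<in>tuples (universe N) (arity V p). \<forall>us\<in>tuples (universe S) (arity V p).
       list_all2 P us xs \<longrightarrow> interp N p xs \<sqsubseteq> interp S p us)"
proof -
  \<comment> \<open>The condition on a single predicate, in a form common to the nullary and the
    positive arities.\<close>
  define Q where "Q p \<longleftrightarrow>
    (\<forall>xs\<in>tuples (universe N) (arity V p). \<forall>us\<in>tuples (universe S) (arity V p).
       list_all2 P us xs \<longrightarrow> interp N p xs \<sqsubseteq> interp S p us)" for p
  have fin_preds: "finite (preds_of_arity V r)" for r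
    using V by (simp add: vocabulary_def preds_of_arity_def)
  \<comment> \<open>The empty list is the only tuple of length \<open>0\<close> and is related to
    itself.\<close>
  have nullary: "sat N Map.empty (literal p (interp S p []) []) \<longleftrightarrow> Q p"
    if "p \<in> preds_of_arity V 0" for p
  proof -
    have "interp N p [] \<in> {Zero, One}"
      using two_valued_interp[OF N, of p "[]"] that by (simp add: preds_of_arity_def tuples_def)
    with that show ?thesis by (simp add: Q_def preds_of_arity_def tuples_def sat_literal)
  qed
  have positive: "sat N Map.empty (Foralls [1..<Suc r] (BigConj (tuples (universe S) r) (\<lambda>us.
        Impl (BigConj {1..r} (\<lambda>j. subst_var (nd (us ! (j - 1))) w j))
          (literal p (interp S p us) [1..<Suc r])))) \<longleftrightarrow> Q p"
    if p: "p \<in> preds_of_arity V r" for p r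
  proof -
    have body: "sat N ([[1..<Suc r] [\<mapsto>] xs]) (Impl (BigConj {1..r} (\<lambda>j. subst_var (nd (us ! (j - 1))) w j))
          (literal p (interp S p us) [1..<Suc r])) \<longleftrightarrow>
        (list_all2 P us xs \<longrightarrow> interp N p xs \<sqsubseteq> interp S p us)"
      if xs: "xs \<in> tuples (universe N) r" and us: "us \<in> tuples (universe S) r" for xs us
    proof -
      let ?Z = "[[1..<Suc r] [\<mapsto>] xs]"
      have len: "length xs = r" "length us = r" using xs us by (auto simp: tuples_def)
      \<comment> \<open>Variables count from \<open>1\<close> but list positions from
        \<open>0\<close>, so variable \<open>Suc i\<close> holds component \<open>i\<close>.\<close>
      have Z: "?Z (Suc i) = Some (xs ! i)" if "i < r" for i
        using map_upds_nth[of "[1..<Suc r]" xs i Map.empty] that len by (simp del: upt_Suc)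
      have map_Z: "map (\<lambda>x. the (?Z x)) [1..<Suc r] = xs"
        by (rule nth_equalityI) (simp_all add: len Z plus_1_eq_Suc del: upt_Suc One_nat_def)
      have node: "sat N ?Z (subst_var (nd (us ! i)) w (Suc i)) \<longleftrightarrow> P (us ! i) (xs ! i)" if "i < r" for i
      proof -
        have "us ! i \<in> universe S" using us that len by (auto simp: tuples_def)
        then show ?thesis unfolding P_def by (intro sat_subst_var fv[rule_format] Z that)
      qed
      \<comment> \<open>Reindexing along \<open>j = Suc i\<close> turns the premise of the
        implication into a componentwise relation of lists.\<close>
      have "(\<forall>j\<in>{1..r}. sat N ?Z (subst_var (nd (us ! (j - 1))) w j)) \<longleftrightarrow>
          (\<forall>i<r. sat N ?Z (subst_var (nd (us ! i)) w (Suc i)))"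
        unfolding image_Suc_lessThan[symmetric] by (auto simp del: upt_Suc)
      also have "\<dots> \<longleftrightarrow> list_all2 P us xs" by (simp add: node list_all2_conv_all_nth len del: upt_Suc One_nat_def)
      finally have nodes: "(\<forall>j\<in>{1..r}. sat N ?Z (subst_var (nd (us ! (j - 1))) w j)) \<longleftrightarrow>
          list_all2 P us xs" .
      have "interp N p xs \<in> {Zero, One}"
        using two_valued_interp[OF N, of p xs] p xs by (simp add: preds_of_arity_def)
      then have "sat N ?Z (literal p (interp S p us) [1..<Suc r]) \<longleftrightarrow> interp N p xs \<sqsubseteq> interp S p us"
        using sat_literal[of N p ?Z "[1..<Suc r]"] by (simp only: map_Z)
      then show ?thesis by (simp only: sat.simps sat_BigConj finite_atLeastAtMost nodes)
    qed
    have "arity V p = r" using p by (simp add: preds_of_arity_def)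
    moreover have "length [1..<Suc r] = r" by simp
    ultimately show ?thesis
      by (simp only: Q_def sat_Foralls sat_BigConj[OF finite_tuples[OF fin]] body cong: ball_cong)
  qed
  have ex: "sat N Map.empty (Exists 0 (subst_var (nd u) w 0)) \<longleftrightarrow> (\<exists>x\<in>universe N. P u x)"
    if "u \<in> universe S" for u
    unfolding P_def using fv that by (simp add: sat_subst_var)
  have arity: "arity V p \<le> maxR V" if "p \<in> preds V" for p
    using V that by (simp add: vocabulary_def maxR_def)
  \<comment> \<open>No arity exceeds \<open>maxR V\<close>, so the nullary and positive conjuncts
    together cover the whole vocabulary.\<close>
  have "(\<forall>p\<in>preds_of_arity V 0. Q p) \<and> (\<forall>r\<in>{1..maxR V}. \<forall>p\<in>preds_of_arity V r. Q p) \<longleftrightarrow>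
      (\<forall>p\<in>preds V. Q p)"
    using arity by (fastforce simp: preds_of_arity_def)
  then show ?thesis
    unfolding models_def xi_def Q_def[symmetric]
    by (simp only: sat.simps(5,9) sat_BigConj[OF fin] sat_BigDisj[OF fin] sat_BigConj[OF fin_preds]
        sat_BigConj[OF finite_atLeastAtMost] ex nullary positive P_def cong: ball_cong)
qed

theorem theorem1:
  fixes V :: "'p vocab" and F :: "'p form"
    and S :: "('p, 'a) struct" and w :: var and nd :: "'a \<Rightarrow> 'p form"
    and N :: "('p, 'b) struct"
  assumes "vocabulary V"
    and "wff V F" and "fv F = {}"
    and "three_valued V S" and "finite (universe S)"
    and "FO_identifiable_by TYPE('b) V S w nd"
    and "two_valued V N"
  shows "N \<in> concretization V F S \<longleftrightarrow> N \<Turnstile> gamma_hat V F S w nd"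
proof -
  let ?P = "\<lambda>u x. sat N [w \<mapsto> x] (nd u)"
  have "\<forall>u\<in>universe S. fv (nd u) \<subseteq> {w}"
    using assms(6) unfolding FO_identifiable_by_def by blast
  note xi = models_xi[OF assms(1,5) this assms(7)]
  \<comment> \<open>\<open>N\<close> is two-valued by assumption and \<open>F\<close> occurs on both
    sides, so only this equivalence remains.\<close>
  have "embeds V N S \<longleftrightarrow> N \<Turnstile> xi V S w nd"
  proof
    assume "embeds V N S"
    then obtain f where f: "embeds_via V f N S" by (auto simp: embeds_def)
    have node: "?P u x \<longleftrightarrow> f x = u" if "x \<in> universe N" "u \<in> universe S" for x u
      using assms(6,7) f that unfolding FO_identifiable_by_def by blast
    have image: "f ` universe N = universe S" using f by (simp add: embeds_via_def)
    have "interp N p xs \<sqsubseteq> interp S p us"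
      if "p \<in> preds V" and xs: "xs \<in> tuples (universe N) (arity V p)"
        and us: "us \<in> tuples (universe S) (arity V p)" and "list_all2 ?P us xs" for p xs us
    proof -
      \<comment> \<open>By \<open>node\<close>, being related componentwise to \<open>xs\<close>
        pins \<open>us\<close> down as its image, where the embedding condition applies.\<close>
      have "us = map f xs"
        using that node by (auto simp: list_all2_conv_all_nth tuples_def subset_iff intro!: nth_equalityI)
      with f that(1) xs show ?thesis by (simp add: embeds_via_def)
    qed
    moreover have "\<exists>x\<in>universe N. ?P u x" if "u \<in> universe S" for u
      using that node image by (metis imageE)
    moreover have "\<exists>u\<in>universe S. ?P u x" if "x \<in> universe N" for x
      using that node image by (metis imageI)
    ultimately show "N \<Turnstile> xi V S w nd" unfolding xi by blast
  next
    assume "N \<Turnstile> xi V S w nd"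
    then have inhabited: "\<And>u. u \<in> universe S \<Longrightarrow> \<exists>x\<in>universe N. ?P u x"
      and total: "\<forall>x\<in>universe N. \<exists>u. u \<in> universe S \<and> ?P u x"
      and preds: "\<And>p xs us. \<lbrakk>p \<in> preds V; xs \<in> tuples (universe N) (arity V p);
        us \<in> tuples (universe S) (arity V p); list_all2 ?P us xs\<rbrakk> \<Longrightarrow> interp N p xs \<sqsubseteq> interp S p us"
      unfolding xi by blast+
    obtain f where f: "\<And>x. x \<in> universe N \<Longrightarrow> f x \<in> universe S \<and> ?P (f x) x"
      using bchoice[OF total] by blast
    have exclusive: "u = u'" if x: "x \<in> universe N" "?P u x" "?P u' x"
      and u: "u \<in> universe S" "u' \<in> universe S" for x u u'
    proof (rule ccontr)
      assume "u \<noteq> u'"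
      then have "interp S (eqsym V) [u, u'] = Zero"
        using assms(4) u by (simp add: three_valued_def)
      moreover have "interp N (eqsym V) [x, x] = One"
        using assms(7) x by (simp add: two_valued_def)
      \<comment> \<open>Since \<open>x\<close> satisfies both node formulas, \<open>[x, x]\<close>
        is related to \<open>[u, u']\<close>. This would give
        \<open>One \<sqsubseteq> Zero\<close>.\<close>
      moreover have "interp N (eqsym V) [x, x] \<sqsubseteq> interp S (eqsym V) [u, u']"
        by (rule preds) (use assms(1) x u in \<open>auto simp: vocabulary_def tuples_def\<close>)
      ultimately show False by (simp add: info_le_def)
    qed
    have "f ` universe N = universe S"
    proof (intro equalityI subsetI)
      fix u assume "u \<in> universe S"
      \<comment> \<open>The choice might have sent \<open>x\<close> to another node whose formula it
        satisfies; exclusivity forces \<open>f x = u\<close>.\<close>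
      moreover from this obtain x where "x \<in> universe N" "?P u x" using inhabited by blast
      ultimately show "u \<in> f ` universe N" using exclusive f by blast
    qed (use f in blast)
    \<comment> \<open>Each \<open>f x\<close> was chosen so that its node formula holds at
      \<open>x\<close>; hence \<open>map f xs\<close> is related to \<open>xs\<close> and
      \<open>preds\<close> applies.\<close>
    moreover have "interp N p xs \<sqsubseteq> interp S p (map f xs)"
      if "p \<in> preds V" "xs \<in> tuples (universe N) (arity V p)" for p xs
      by (rule preds[OF that]) (use that(2) f in \<open>auto simp: tuples_def list_all2_conv_all_nth subset_iff\<close>)
    ultimately show "embeds V N S" unfolding embeds_def embeds_via_def by blast
  qed
  with assms(7) show ?thesis
    by (auto simp: concretization_def concretization_set_def gamma_hat_def models_def)
qed

end
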